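(* Let $G_1$ and $G_2$ be two trees such that $G_1\subset G_2$, that is, $G_2$ is obtained from $G_1$ by adding finitely many new edges (together with the new vertices they require). Let $k_1$ and $k_2$ denote the number of interior vertices of $G_1$ and $G_2$, respectively. Then for every $1\le i\le k_1$, $$\lambda_i(G_2)\ \le\ \lambda_i(G_1)\ \le\ \lambda_{i+k_2-k_1}(G_2).$$
   Context: All trees are finite (connected, acyclic, simple, undirected) with at least $3$ vertices. For a tree $G=(V,E)$ the boundary $\delta\Omega_G$ is the set of all vertices of degree one, and the interior is $\Omega_G=V\setminus\delta\Omega_G$; $k=|\Omega_G|$ is the number of interior vertices. Write $x\sim y$ for adjacency. For $f\in\mathbb{R}^V$ put $(\Delta f)(x)=\sum_{y\sim x}(f(x)-f(y))$ for $x\in V$, and $\frac{\partial f}{\partial\nu}(x)=\sum_{y\in\Omega_G,\,y\sim x}(f(x)-f(y))$ for $x\in\delta\Omega_G$. The Neumann eigenvalue problem asks for nonzero $f\in\mathbb{R}^V$ and $\lambda\in\mathbb{R}$ with $\Delta f=\lambda f$ on $\Omega_G$ and $\frac{\partial f}{\partial \nu}=0$ on $\delta\Omega_G$. Equivalently, the Neumann eigenvalues are the eigenvalues of $\Delta^N:\mathbb{R}^{\Omega_G}\to\mathbb{R}^{\Omega_G}$, $\Delta^N f=\Delta(\Lambda f)|_{\Omega_G}$, where $\Lambda f=f$ on $\Omega_G$ and $(\Lambda f)(x)=\frac{1}{\deg(x)}\sum_{y\sim x}f(y)$ for $x\in\delta\Omega_G$. The operator $\Delta^N$ is self-adjoint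 and non-negative, and its eigenvalues, counted with multiplicity, are listed as $0=\lambda_1(G)<\lambda_2(G)\le\cdots\le\lambda_k(G)$. *)

theory Defs
  imports Complex_Main "HOL-Library.Function_Algebras" "Graph_Theory.Graph_Theory"
begin

text \<open>
  Simple undirected graphs are the symmetric, loop-free pair digraphs of
  \<^locale>\<open>pair_graph\<close>, so every edge is a pair of opposite arcs. The library's
  \<^const>\<open>forest\<close> and \<^const>\<open>tree\<close> do not fit this encoding: they count the closed walk
  \<open>u, v, u\<close> along a single edge as a cycle. The cycles of the undirected graph are the
  directed cycles of length at least 3.
\<close>

definition undirected_tree :: "'a pair_pre_digraph \<Rightarrow> bool" where
  "undirected_tree G \<longleftrightarrow>
     pair_graph G \<and> connected (with_proj G) \<and>
     \<not> (\<exists>p. pre_digraph.cycle (with_proj G) p \<and> 3 \<le> length p)"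

definition neighbours :: "'a pair_pre_digraph \<Rightarrow> 'a \<Rightarrow> 'a set" where
  "neighbours G x = {y. (x, y) \<in> parcs G}"

text \<open>By symmetry of the arc relation the out-degree is the degree of the undirected graph.\<close>

definition boundary :: "'a pair_pre_digraph \<Rightarrow> 'a set" where
  "boundary G = {x \<in> pverts G. out_degree (with_proj G) x = 1}"

definition interior_verts :: "'a pair_pre_digraph \<Rightarrow> 'a set" where
  "interior_verts G = pverts G - boundary G"

definition laplacian :: "'a pair_pre_digraph \<Rightarrow> ('a \<Rightarrow> real) \<Rightarrow> 'a \<Rightarrow> real" where
  "laplacian G f x = (\<Sum>y\<in>neighbours G x. f x - f y)"

definition neumann_extension :: "'a pair_pre_digraph \<Rightarrow> ('a \<Rightarrow> real) \<Rightarrow> 'a \<Rightarrow> real" where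
  "neumann_extension G f x =
     (if x \<in> boundary G
      then (\<Sum>y\<in>neighbours G x. f y) / real (out_degree (with_proj G) x)
      else f x)"

text \<open>
  Functions on the interior are represented by functions on the whole vertex type that
  vanish off the interior. In particular the sum in \<^const>\<open>neumann_extension\<close> then only
  sees values at interior vertices.
\<close>

definition interior_functions :: "'a pair_pre_digraph \<Rightarrow> ('a \<Rightarrow> real) set" where
  "interior_functions G = {f. \<forall>x. x \<notin> interior_verts G \<longrightarrow> f x = 0}"

definition neumann_laplacian :: "'a pair_pre_digraph \<Rightarrow> ('a \<Rightarrow> real) \<Rightarrow> 'a \<Rightarrow> real" where
  "neumann_laplacian G f x =
     (if x \<in> interior_verts G then laplacian G (neumann_extension G f) x else 0)"

definition fun_scale :: "real \<Rightarrow> ('a \<Rightarrow> real) \<Rightarrow> 'a \<Rightarrow> real" where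
  "fun_scale c f = (\<lambda>x. c * f x)"

lemma vector_space_fun_scale: "vector_space fun_scale"
  by unfold_locales (auto simp: fun_scale_def fun_eq_iff algebra_simps)

definition neumann_eigenspace :: "'a pair_pre_digraph \<Rightarrow> real \<Rightarrow> ('a \<Rightarrow> real) set" where
  "neumann_eigenspace G t =
     {f \<in> interior_functions G. neumann_laplacian G f = fun_scale t f}"

definition neumann_spectrum :: "'a pair_pre_digraph \<Rightarrow> real set" where
  "neumann_spectrum G = {t. \<exists>f \<in> neumann_eigenspace G t. f \<noteq> 0}"

definition neumann_multiplicity :: "'a pair_pre_digraph \<Rightarrow> real \<Rightarrow> nat" where
  "neumann_multiplicity G t = vector_space.dim fun_scale (neumann_eigenspace G t)"

definition neumann_eigenvalues :: "'a pair_pre_digraph \<Rightarrow> real list" where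
  "neumann_eigenvalues G =
     concat (map (\<lambda>t. replicate (neumann_multiplicity G t) t)
                 (sorted_list_of_set (neumann_spectrum G)))"

text \<open>
  The eigenvalues are numbered from 1. The operator is self-adjoint, so the list has
  \<open>card (interior_verts G)\<close> entries and indices from 1 up to this number are in range.
\<close>

definition neumann_eigenvalue :: "'a pair_pre_digraph \<Rightarrow> nat \<Rightarrow> real" where
  "neumann_eigenvalue G i = neumann_eigenvalues G ! (i - 1)"

end

theory Submission
  imports Defs "HOL-Analysis.Abstract_Topological_Spaces"
begin

text \<open>
  A leaf of a tree takes the value of its only neighbour under the extension \<open>\<Lambda>\<close>, so the
  arcs to the boundary contribute nothing and the Neumann Laplacian is the ordinary graph
  Laplacian of the subgraph induced on the interior. Its quadratic form is the Dirichlet energy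
  \<open>\<Sum> (f x - f y)\<^sup>2\<close> over the interior edges (\<open>neumann_form\<close>). Both inequalities are
  comparisons of energies on suitable subspaces, as in the min-max principle.

  For the upper bound on the eigenvalues of the small tree, a function on the interior of the
  large tree that vanishes on the \<open>k2 - k1\<close> added interior vertices is a function on the interior
  of the small tree with the same norm, and dropping edges does not increase its energy. For the
  lower bound, a function on the small tree is extended to the large one by making it constant along everything that hangs
  off each vertex. The added edges then carry no energy, and the norm does not decrease. Such an
  extension exists because the components that remain after deleting the edges of the small tree
  meet it in at most one vertex each: a second vertex would close a cycle
  (\<open>added_arcs_path_unique\<close>).

  The min-max principle is used in a counting form (\<open>eigenvalue_count_comparison\<close>). If \<open>n\<close>
  eigenvalues of the first operator are at most \<open>t\<close>, their eigenvectors span a space of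
  dimension \<open>n\<close> on which the form is at most \<open>t\<close> times the squared norm. If \<open>n\<close> exceeded the
  number of conditions imposed (vanishing at given points, orthogonality of the transferred
  function to the eigenvectors of the second operator with eigenvalue at most \<open>t\<close>), some
  nonzero vector would satisfy all of them, and its transferred form would be larger than
  \<open>t\<close> times the squared norm. Entry \<open>i\<close> of a sorted list is at most \<open>t\<close> exactly when more than
  \<open>i\<close> entries are, so inequalities between counts are inequalities between eigenvalues.

  The counts refer to multiplicities, that is, to dimensions of eigenspaces; these are the
  numbers of basis vectors of each eigenvalue in an orthonormal eigenbasis
  (\<open>spectral_theorem\<close>, \<open>dim_eigenspace\<close>).
\<close>

section \<open>Functions with support in a finite set\<close>

text \<open>
  The vertex sets are not types, so the real functions on a finite set \<open>S\<close> are encoded as the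
  functions on the whole type that vanish off \<open>S\<close>. The inner product below is definite on them.
\<close>

definition functions_on :: "'a set \<Rightarrow> ('a \<Rightarrow> real) set" where
  "functions_on S = {f. \<forall>x. x \<notin> S \<longrightarrow> f x = 0}"

definition inner_on :: "'a set \<Rightarrow> ('a \<Rightarrow> real) \<Rightarrow> ('a \<Rightarrow> real) \<Rightarrow> real" where
  "inner_on S f g = (\<Sum>x\<in>S. f x * g x)"

lemma inner_on_commute: "inner_on S f g = inner_on S g f"
  by (simp add: inner_on_def mult.commute)

lemma inner_on_add_left: "inner_on S (\<lambda>x. f x + g x) h = inner_on S f h + inner_on S g h"
  and inner_on_diff_left: "inner_on S (\<lambda>x. f x - g x) h = inner_on S f h - inner_on S g h"
  and inner_on_scale_left: "inner_on S (\<lambda>x. c * f x) h = c * inner_on S f h"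
  by (simp_all add: inner_on_def algebra_simps sum.distrib sum_subtractf sum_distrib_left)

lemma inner_on_add_right: "inner_on S h (\<lambda>x. f x + g x) = inner_on S h f + inner_on S h g"
  and inner_on_diff_right: "inner_on S h (\<lambda>x. f x - g x) = inner_on S h f - inner_on S h g"
  and inner_on_scale_right: "inner_on S h (\<lambda>x. c * f x) = c * inner_on S h f"
  by (simp_all add: inner_on_commute[of S h] inner_on_add_left inner_on_diff_left inner_on_scale_left)

lemma inner_on_sum_left: "inner_on S (\<lambda>x. \<Sum>i\<in>I. c i * f i x) h = (\<Sum>i\<in>I. c i * inner_on S (f i) h)"
proof -
  have "inner_on S (\<lambda>x. \<Sum>i\<in>I. c i * f i x) h = (\<Sum>x\<in>S. \<Sum>i\<in>I. c i * (f i x * h x))"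
    by (simp add: inner_on_def sum_distrib_right mult.assoc)
  also have "\<dots> = (\<Sum>i\<in>I. \<Sum>x\<in>S. c i * (f i x * h x))"
    by (rule sum.swap)
  finally show ?thesis by (simp add: inner_on_def sum_distrib_left)
qed

lemma inner_on_sum_right: "inner_on S h (\<lambda>x. \<Sum>i\<in>I. c i * f i x) = (\<Sum>i\<in>I. c i * inner_on S h (f i))"
  by (simp add: inner_on_commute[of S h] inner_on_sum_left)

lemmas inner_on_linear = inner_on_add_left inner_on_diff_left inner_on_scale_left inner_on_sum_left
  inner_on_add_right inner_on_diff_right inner_on_scale_right inner_on_sum_right

lemma inner_on_self_nonneg: "0 \<le> inner_on S f f"
  by (simp add: inner_on_def sum_nonneg)

lemma inner_on_self_eq_0_iff:
  assumes "finite S" "f \<in> functions_on S"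
  shows "inner_on S f f = 0 \<longleftrightarrow> f = (\<lambda>x. 0)"
proof
  assume "inner_on S f f = 0"
  then have "\<forall>x\<in>S. f x = 0"
    using assms(1) by (simp add: inner_on_def sum_nonneg_eq_0_iff)
  then show "f = (\<lambda>x. 0)" using assms(2) by (auto simp: functions_on_def)
qed (simp add: inner_on_def)

definition mat_op :: "'a set \<Rightarrow> ('a \<Rightarrow> 'a \<Rightarrow> real) \<Rightarrow> ('a \<Rightarrow> real) \<Rightarrow> 'a \<Rightarrow> real" where
  "mat_op S a f x = (if x \<in> S then \<Sum>y\<in>S. a x y * f y else 0)"

text \<open>
  The derivative test at a maximum: a linear function of \<open>t\<close> that is bounded above by a multiple
  of \<open>t\<^sup>2\<close> has no positive slope at 0.
\<close>

lemma linear_le_quadratic: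
  fixes b c :: real
  assumes "\<And>t. 2 * t * b \<le> t * t * c" "0 \<le> c"
  shows "b \<le> 0"
proof (rule ccontr)
  assume "\<not> b \<le> 0"
  then have b: "0 < b" by simp
  define t where "t = b / (c + 1)"
  have t: "0 < t" using b assms(2) by (simp add: t_def)
  have "t * (2 * b) \<le> t * (t * c)"
    using assms(1)[of t] by (simp add: mult_ac)
  then have "2 * b \<le> t * c" using t by simp
  moreover have "t * c \<le> b"
    using b assms(2) by (simp add: t_def field_simps)
  ultimately show False using b by simp
qed

locale symmetric_matrix =
  fixes S :: "'a set" and a :: "'a \<Rightarrow> 'a \<Rightarrow> real"
  assumes finite_index: "finite S"
    and symmetric: "x \<in> S \<Longrightarrow> y \<in> S \<Longrightarrow> a x y = a y x"
begin

abbreviation "A \<equiv> mat_op S a"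

lemma A_in: "A f \<in> functions_on S"
  by (simp add: mat_op_def functions_on_def)

lemma A_add: "A (\<lambda>x. f x + g x) = (\<lambda>x. A f x + A g x)"
  and A_scale: "A (\<lambda>x. c * f x) = (\<lambda>x. c * A f x)"
  by (auto simp: mat_op_def fun_eq_iff algebra_simps sum.distrib sum_distrib_left)

lemma A_self_adjoint: "inner_on S (A f) g = inner_on S f (A g)"
proof -
  have "inner_on S (A f) g = (\<Sum>x\<in>S. \<Sum>y\<in>S. a x y * f y * g x)"
    by (simp add: inner_on_def mat_op_def sum_distrib_right)
  also have "\<dots> = (\<Sum>y\<in>S. \<Sum>x\<in>S. a x y * f y * g x)"
    by (rule sum.swap)
  also have "\<dots> = (\<Sum>y\<in>S. \<Sum>x\<in>S. f y * (a y x * g x))"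
    by (intro sum.cong refl) (simp add: symmetric)
  finally show ?thesis by (simp add: inner_on_def mat_op_def sum_distrib_left)
qed

text \<open>
  The sphere is a closed subset of a product of intervals over \<open>S\<close> and of single points off
  \<open>S\<close>. In the product topology this product is compact by Tychonoff's theorem, even if the type
  is infinite.
\<close>

lemma compact_unit_sphere:
  "compact {f \<in> functions_on S. (\<forall>e\<in>E. inner_on S f e = 0) \<and> inner_on S f f = 1}" (is "compact ?K")
proof -
  let ?I = "\<lambda>x. if x \<in> S then {-1..1::real} else {0}"
  let ?C = "{f. (\<forall>e\<in>E. inner_on S f e = 0) \<and> inner_on S f f = 1}"
  have "compactin (product_topology (\<lambda>x::'a. euclidean) UNIV) (Pi\<^sub>E UNIV ?I)"
    by (subst compactin_PiE) auto
  then have "compact (Pi\<^sub>E UNIV ?I)"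
    by (simp add: euclidean_product_topology)
  moreover have "closed ?C"
    unfolding inner_on_def
    by (auto simp: Ball_def intro!: closed_Collect_conj closed_Collect_all closed_Collect_imp
        closed_Collect_eq continuous_intros continuous_on_product_coordinates)
  ultimately have "compact (Pi\<^sub>E UNIV ?I \<inter> ?C)"
    by (rule compact_Int_closed)
  moreover have "?K = Pi\<^sub>E UNIV ?I \<inter> ?C"
  proof -
    have "f \<in> functions_on S" if f: "f \<in> Pi\<^sub>E UNIV ?I" for f
      unfolding functions_on_def
    proof safe
      fix x assume "x \<notin> S"
      then show "f x = 0" using PiE_mem[OF f UNIV_I, of x] by simp
    qed
    moreover have "f \<in> Pi\<^sub>E UNIV ?I" if f: "f \<in> functions_on S" "inner_on S f f = 1" for f
    proof (rule PiE_I)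
      fix x
      show "f x \<in> ?I x"
      proof (cases "x \<in> S")
        case True
        have "f x * f x \<le> inner_on S f f"
          unfolding inner_on_def using True finite_index by (intro member_le_sum) auto
        then have "\<bar>f x\<bar> \<le> 1"
          using f(2) abs_square_le_1[of "f x"] by (simp add: power2_eq_square)
        then show ?thesis using True by (auto simp: abs_le_iff)
      qed (use f in \<open>auto simp: functions_on_def\<close>)
    qed simp
    ultimately show ?thesis by blast
  qed
  ultimately show ?thesis by simp
qed

text \<open>
  The quadratic form attains its maximum on the unit sphere of the orthogonal complement of
  \<open>E\<close>, and a maximiser is an eigenvector. The complement is invariant because \<open>E\<close> consists
  of eigenvectors and the operator is self-adjoint.
\<close>

lemma exists_eigenvector_orthogonal:
  assumes E: "\<And>e. e \<in> E \<Longrightarrow> e \<in> functions_on S"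
    and eig: "\<And>e. e \<in> E \<Longrightarrow> \<exists>m. A e = fun_scale m e"
    and h: "h \<in> functions_on S" "h \<noteq> (\<lambda>x. 0)" "\<And>e. e \<in> E \<Longrightarrow> inner_on S h e = 0"
  obtains f m where "f \<in> functions_on S" "inner_on S f f = 1" "\<And>e. e \<in> E \<Longrightarrow> inner_on S f e = 0"
    "A f = fun_scale m f"
proof -
  let ?K = "{f \<in> functions_on S. (\<forall>e\<in>E. inner_on S f e = 0) \<and> inner_on S f f = 1}"
  have normalize: "(\<lambda>x. inverse (sqrt (inner_on S g g)) * g x) \<in> ?K"
    if "g \<in> functions_on S" "\<forall>e\<in>E. inner_on S g e = 0" "inner_on S g g \<noteq> 0" for g
  proof -
    have "inner_on S g g > 0" using that(3) inner_on_self_nonneg[of S g] by simp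
    then have "inverse (sqrt (inner_on S g g)) * (inverse (sqrt (inner_on S g g)) * inner_on S g g) = 1"
      by (simp add: field_simps)
    then show ?thesis using that by (auto simp: functions_on_def inner_on_linear)
  qed
  have "inner_on S h h \<noteq> 0" using h inner_on_self_eq_0_iff[OF finite_index h(1)] by simp
  then have "?K \<noteq> {}" using normalize[of h] h by blast
  moreover have "continuous_on ?K (\<lambda>f. inner_on S f (A f))"
    unfolding inner_on_def mat_op_def
    by (rule continuous_on_subset[OF _ subset_UNIV])
       (auto intro!: continuous_intros continuous_on_product_coordinates)
  ultimately have "\<exists>f\<in>?K. \<forall>g\<in>?K. inner_on S g (A g) \<le> inner_on S f (A f)"
    by (intro continuous_attains_sup compact_unit_sphere)
  then obtain f where f: "f \<in> ?K" and max: "\<forall>g\<in>?K. inner_on S g (A g) \<le> inner_on S f (A f)"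
    by (rule bexE)
  define m where "m = inner_on S f (A f)"
  have max': "inner_on S g (A g) \<le> m * inner_on S g g" if g: "g \<in> functions_on S" "\<forall>e\<in>E. inner_on S g e = 0" for g
  proof (cases "inner_on S g g = 0")
    case True
    then have "g = (\<lambda>x. 0)" using inner_on_self_eq_0_iff[OF finite_index g(1)] by simp
    then show ?thesis by (simp add: inner_on_def)
  next
    case False
    then have pos: "inner_on S g g > 0" using inner_on_self_nonneg[of S g] by simp
    let ?c = "inverse (sqrt (inner_on S g g))"
    have "?c * (?c * inner_on S g (A g)) \<le> m"
      using bspec[OF max normalize[OF g False]] unfolding m_def A_scale inner_on_linear .
    moreover have "?c * ?c = inverse (inner_on S g g)"
      using pos by (simp flip: inverse_mult_distrib)
    ultimately have "inverse (inner_on S g g) * inner_on S g (A g) \<le> m"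
      by (simp flip: mult.assoc)
    then show ?thesis using pos by (simp add: field_simps)
  qed
  \<comment> \<open>The residual of the eigenvalue equation. It lies in the complement, so it is
    an admissible direction of variation of the maximiser, and the variation has slope proportional
    to its squared norm.\<close>
  define g where "g = (\<lambda>x. A f x - m * f x)"
  have gF: "g \<in> functions_on S"
    using f A_in[of f] by (auto simp: g_def functions_on_def)
  have g_orth: "\<forall>e\<in>E. inner_on S g e = 0"
  proof
    fix e assume e: "e \<in> E"
    obtain k where "A e = fun_scale k e" using eig[OF e] ..
    then have "inner_on S (A f) e = k * inner_on S f e"
      by (simp add: A_self_adjoint fun_scale_def inner_on_linear)
    then show "inner_on S g e = 0" using f e by (simp add: g_def inner_on_linear)
  qed
  have gg: "inner_on S g g = inner_on S f (A g) - m * inner_on S f g"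
    by (subst g_def) (simp only: inner_on_linear A_self_adjoint)
  have "inner_on S g g = 0"
  proof (rule ccontr)
    assume "inner_on S g g \<noteq> 0"
    then have b: "inner_on S g g > 0" (is "?b > 0") using inner_on_self_nonneg[of S g] by simp
    let ?c = "m * inner_on S g g - inner_on S g (A g)"
    have c: "?c \<ge> 0" using max'[OF gF g_orth] by simp
    have bound: "2 * t * ?b \<le> t * t * ?c" for t
    proof -
      let ?p = "\<lambda>x. f x + t * g x"
      have "inner_on S ?p (A ?p) \<le> m * inner_on S ?p ?p"
        using f gF g_orth by (intro max') (auto simp: functions_on_def inner_on_linear)
      moreover have "inner_on S ?p (A ?p) = m + 2 * t * inner_on S f (A g) + t * t * inner_on S g (A g)"
        using A_self_adjoint[of f g] inner_on_commute[of S g "A f"]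
        by (simp add: A_add A_scale inner_on_linear m_def algebra_simps)
      moreover have "inner_on S ?p ?p = 1 + 2 * t * inner_on S f g + t * t * inner_on S g g"
        using f inner_on_commute[of S g f] by (simp add: inner_on_linear algebra_simps)
      ultimately show ?thesis by (simp add: gg algebra_simps)
    qed
    then show False using linear_le_quadratic[OF _ c, of ?b] b by simp
  qed
  then have "g = (\<lambda>x. 0)" using inner_on_self_eq_0_iff[OF finite_index gF] by simp
  then have "A f = fun_scale m f"
    by (auto simp: g_def fun_eq_iff fun_scale_def)
  with f show thesis by (intro that[of f m]) auto
qed

end

section \<open>Orthonormal eigenbases\<close>

definition orthonormal :: "'a set \<Rightarrow> ('a \<Rightarrow> real) set \<Rightarrow> bool" where
  "orthonormal S E \<longleftrightarrow> finite E \<and> E \<subseteq> functions_on S \<and>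
     (\<forall>e\<in>E. \<forall>d\<in>E. inner_on S e d = (if e = d then 1 else 0))"

lemma orthonormal_coefficient:
  assumes "orthonormal S E" "B \<subseteq> E" "d \<in> E"
  shows "inner_on S (\<lambda>x. \<Sum>e\<in>B. c e * e x) d = (if d \<in> B then c d else 0)"
proof -
  have "finite B" using assms finite_subset by (auto simp: orthonormal_def)
  have "inner_on S (\<lambda>x. \<Sum>e\<in>B. c e * e x) d = (\<Sum>e\<in>B. c e * inner_on S e d)"
    by (rule inner_on_sum_left)
  also have "\<dots> = (\<Sum>e\<in>B. if e = d then c e else 0)"
    using assms by (intro sum.cong) (auto simp: orthonormal_def)
  finally show ?thesis using \<open>finite B\<close> by simp
qed

lemma orthonormal_remainder:
  assumes "orthonormal S E" "d \<in> E"
  shows "inner_on S (\<lambda>x. f x - (\<Sum>e\<in>E. inner_on S f e * e x)) d = 0"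
  using orthonormal_coefficient[OF assms(1) order_refl assms(2), of "inner_on S f"] assms(2)
  by (simp add: inner_on_diff_left)

text \<open>
  The squared norm of the remainder of \<open>f\<close> after projection is \<open>\<langle>f, f\<rangle>\<close> minus the sum on the
  left.
\<close>

lemma Bessel:
  assumes "orthonormal S E"
  shows "(\<Sum>e\<in>E. (inner_on S f e)\<^sup>2) \<le> inner_on S f f"
proof -
  let ?p = "\<lambda>x. \<Sum>e\<in>E. inner_on S f e * e x"
  let ?r = "\<lambda>x. f x - ?p x"
  have "inner_on S ?r ?p = (\<Sum>e\<in>E. inner_on S f e * inner_on S ?r e)"
    by (rule inner_on_sum_right)
  also have "\<dots> = 0"
    using orthonormal_remainder[OF assms] by simp
  finally have "inner_on S ?r f = inner_on S ?r ?r" by (simp add: inner_on_diff_right)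
  then have "0 \<le> inner_on S ?r f" using inner_on_self_nonneg[of S ?r] by simp
  then show ?thesis
    by (simp add: inner_on_diff_left inner_on_sum_left power2_eq_square inner_on_commute)
qed

lemma inner_on_indicator:
  assumes "finite S" "x \<in> S"
  shows "inner_on S (\<lambda>y. if y = x then 1 else 0) f = f x"
proof -
  have "inner_on S (\<lambda>y. if y = x then 1 else 0) f = (\<Sum>y\<in>S. if y = x then f y else 0)"
    unfolding inner_on_def by (intro sum.cong) auto
  then show ?thesis using assms by simp
qed

text \<open>
  The trace of the projection onto the span, computed once in \<open>E\<close> and once in the basis of
  point masses. It bounds the size of an orthonormal set and gives the size of an orthonormal
  basis.
\<close>

lemma orthonormal_card_eq:
  assumes "orthonormal S E"
  shows "real (card E) = (\<Sum>x\<in>S. \<Sum>e\<in>E. (e x)\<^sup>2)"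
proof -
  have "real (card E) = (\<Sum>e\<in>E. inner_on S e e)"
    using assms by (simp add: orthonormal_def)
  also have "\<dots> = (\<Sum>x\<in>S. \<Sum>e\<in>E. (e x)\<^sup>2)"
    unfolding inner_on_def by (subst sum.swap) (simp add: power2_eq_square)
  finally show ?thesis .
qed

lemma orthonormal_card_le:
  assumes "finite S" "orthonormal S E"
  shows "card E \<le> card S"
proof -
  have "real (card E) = (\<Sum>x\<in>S. \<Sum>e\<in>E. (e x)\<^sup>2)"
    by (rule orthonormal_card_eq[OF assms(2)])
  also have "\<dots> \<le> (\<Sum>x\<in>S. 1)"
  proof (rule sum_mono)
    fix x assume x: "x \<in> S"
    show "(\<Sum>e\<in>E. (e x)\<^sup>2) \<le> 1"
      using Bessel[OF assms(2), of "\<lambda>y. if y = x then 1 else 0"] x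
      by (simp add: inner_on_indicator assms(1))
  qed
  finally show ?thesis by simp
qed

text \<open>
  Here \<open>ev e\<close> is the eigenvalue of \<open>e\<close>. The eigenvector equations, the expansion and
  self-adjointness together diagonalise the quadratic form (\<open>form_expansion\<close>).
\<close>

locale eigenbasis =
  fixes S :: "'a set" and A :: "('a \<Rightarrow> real) \<Rightarrow> 'a \<Rightarrow> real" and E :: "('a \<Rightarrow> real) set"
    and ev :: "('a \<Rightarrow> real) \<Rightarrow> real"
  assumes finite_index: "finite S"
    and orthonormal: "orthonormal S E"
    and expansion: "f \<in> functions_on S \<Longrightarrow> (\<lambda>x. \<Sum>e\<in>E. inner_on S f e * e x) = f"
    and eigenvector: "e \<in> E \<Longrightarrow> A e = fun_scale (ev e) e"
    and self_adjoint: "f \<in> functions_on S \<Longrightarrow> g \<in> functions_on S \<Longrightarrow> inner_on S (A f) g = inner_on S f (A g)"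

text \<open>
  An orthonormal set of eigenvectors of maximal size is complete, since a nonzero vector
  orthogonal to it would yield a further eigenvector.
\<close>

theorem (in symmetric_matrix) spectral_theorem:
  obtains E ev where "eigenbasis S A E ev"
proof -
  let ?P = "\<lambda>E. orthonormal S E \<and> (\<forall>e\<in>E. \<exists>m. A e = fun_scale m e)"
  have "?P {}" by (simp add: orthonormal_def)
  moreover have "\<forall>D. ?P D \<longrightarrow> card D < Suc (card S)"
    using orthonormal_card_le[OF finite_index] by (simp add: less_Suc_eq_le)
  ultimately have "\<exists>E. ?P E \<and> (\<forall>D. ?P D \<longrightarrow> card D \<le> card E)"
    by (rule ex_has_greatest_nat)
  then obtain E where E: "orthonormal S E" and eig: "\<And>e. e \<in> E \<Longrightarrow> \<exists>m. A e = fun_scale m e"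
    and max: "\<And>D. ?P D \<Longrightarrow> card D \<le> card E" by metis
  have EF: "\<And>e. e \<in> E \<Longrightarrow> e \<in> functions_on S" and "finite E"
    using E by (auto simp: orthonormal_def)
  have complete: "f = (\<lambda>x. 0)"
    if f: "f \<in> functions_on S" "\<And>e. e \<in> E \<Longrightarrow> inner_on S f e = 0" for f
  proof (rule ccontr)
    assume "f \<noteq> (\<lambda>x. 0)"
    then obtain g m where g: "g \<in> functions_on S" "inner_on S g g = 1" "\<And>e. e \<in> E \<Longrightarrow> inner_on S g e = 0"
        "A g = fun_scale m g"
      using exists_eigenvector_orthogonal[OF EF eig f(1) _ f(2)] by metis
    have "g \<notin> E" using g(2) g(3)[of g] by auto
    moreover have "orthonormal S (insert g E)"
    proof -
      have "inner_on S e g = 0" if "e \<in> E" for e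
        using g(3)[OF that] by (simp add: inner_on_commute)
      then show ?thesis
        using E g(1-3) \<open>g \<notin> E\<close> by (auto simp: orthonormal_def)
    qed
    moreover have "\<exists>m. A e = fun_scale m e" if "e \<in> insert g E" for e
      using that eig g(4) by (cases "e = g") auto
    ultimately show False
      using max[of "insert g E"] \<open>finite E\<close> by simp
  qed
  obtain ev where ev: "\<And>e. e \<in> E \<Longrightarrow> A e = fun_scale (ev e) e" using eig by metis
  have "(\<lambda>x. \<Sum>e\<in>E. inner_on S f e * e x) = f" if f: "f \<in> functions_on S" for f
  proof -
    let ?r = "\<lambda>x. f x - (\<Sum>e\<in>E. inner_on S f e * e x)"
    have "(\<Sum>e\<in>E. inner_on S f e * e x) = 0" if "x \<notin> S" for x
      using EF that by (intro sum.neutral) (auto simp: functions_on_def)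
    then have "?r \<in> functions_on S" using f by (simp add: functions_on_def)
    then have "?r = (\<lambda>x. 0)" by (rule complete) (rule orthonormal_remainder[OF E])
    then show ?thesis by (auto simp: fun_eq_iff)
  qed
  then have "eigenbasis S A E ev"
    by (intro eigenbasis.intro finite_index E ev A_self_adjoint)
  then show thesis by (rule that)
qed

context eigenbasis
begin

lemma finite_basis: "finite E" and basis_in: "e \<in> E \<Longrightarrow> e \<in> functions_on S"
  using orthonormal by (auto simp: orthonormal_def)

lemma basis_nonzero: "e \<in> E \<Longrightarrow> e \<noteq> (\<lambda>x. 0)"
proof
  assume e: "e \<in> E" "e = (\<lambda>x. 0)"
  have "inner_on S e e = 1" using orthonormal e(1) by (simp add: orthonormal_def)
  then show False by (simp add: e(2) inner_on_def)
qed

lemma Parseval: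
  assumes "f \<in> functions_on S"
  shows "inner_on S f g = (\<Sum>e\<in>E. inner_on S f e * inner_on S e g)"
proof -
  have "inner_on S f g = inner_on S (\<lambda>x. \<Sum>e\<in>E. inner_on S f e * e x) g"
    by (simp only: expansion[OF assms])
  then show ?thesis by (simp only: inner_on_sum_left)
qed

lemma norm_expansion: "f \<in> functions_on S \<Longrightarrow> inner_on S f f = (\<Sum>e\<in>E. (inner_on S f e)\<^sup>2)"
  using Parseval[of f f] by (simp add: power2_eq_square inner_on_commute)

lemma image_coefficient:
  "f \<in> functions_on S \<Longrightarrow> e \<in> E \<Longrightarrow> inner_on S e (A f) = ev e * inner_on S f e"
  using self_adjoint[of e f] basis_in[of e] eigenvector[of e]
  by (simp add: fun_scale_def inner_on_scale_left inner_on_commute)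

lemma form_expansion: "f \<in> functions_on S \<Longrightarrow> inner_on S f (A f) = (\<Sum>e\<in>E. ev e * (inner_on S f e)\<^sup>2)"
  using Parseval[of f "A f"] by (simp add: image_coefficient power2_eq_square mult.left_commute)

lemma card_basis: "card E = card S"
proof -
  have "real (card E) = (\<Sum>x\<in>S. \<Sum>e\<in>E. (e x)\<^sup>2)"
    by (rule orthonormal_card_eq[OF orthonormal])
  also have "\<dots> = (\<Sum>x\<in>S. 1)"
  proof (intro sum.cong refl)
    fix x assume x: "x \<in> S"
    \<comment> \<open>Parseval for the point mass at \<open>x\<close>.\<close>
    let ?d = "\<lambda>y. if y = x then 1 else 0 :: real"
    have "?d \<in> functions_on S" using x by (auto simp: functions_on_def)
    then show "(\<Sum>e\<in>E. (e x)\<^sup>2) = 1"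
      using norm_expansion[of ?d] by (simp add: inner_on_indicator x finite_index)
  qed
  finally show ?thesis by simp
qed

lemma combination_in: "B \<subseteq> E \<Longrightarrow> (\<lambda>x. \<Sum>e\<in>B. c e * e x) \<in> functions_on S"
  using basis_in by (auto simp: functions_on_def subset_iff intro!: sum.neutral)

lemma form_combination_le:
  fixes c :: "('a \<Rightarrow> real) \<Rightarrow> real"
  assumes B: "B \<subseteq> {e \<in> E. ev e \<le> t}"
  defines "f \<equiv> \<lambda>x. \<Sum>e\<in>B. c e * e x"
  shows "inner_on S f (A f) \<le> t * inner_on S f f"
proof -
  have BE: "B \<subseteq> E" using B by auto
  have f: "f \<in> functions_on S" unfolding f_def by (rule combination_in[OF BE])
  have "ev e * (inner_on S f e)\<^sup>2 \<le> t * (inner_on S f e)\<^sup>2" if "e \<in> E" for e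
    using orthonormal_coefficient[OF orthonormal BE that, of c] B
    by (cases "e \<in> B") (auto simp: f_def intro!: mult_right_mono)
  then show ?thesis
    by (simp add: form_expansion[OF f] norm_expansion[OF f] sum_distrib_left sum_mono)
qed

lemma form_orthogonal_greater:
  assumes f: "f \<in> functions_on S" "f \<noteq> (\<lambda>x. 0)"
    and orth: "\<And>e. e \<in> E \<Longrightarrow> ev e \<le> t \<Longrightarrow> inner_on S f e = 0"
  shows "t * inner_on S f f < inner_on S f (A f)"
proof -
  have le: "t * (inner_on S f e)\<^sup>2 \<le> ev e * (inner_on S f e)\<^sup>2" if "e \<in> E" for e
    using orth[OF that] by (cases "ev e \<le> t") (auto intro!: mult_right_mono)
  have "inner_on S f f \<noteq> 0" using f inner_on_self_eq_0_iff[OF finite_index] by blast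
  then obtain e where e: "e \<in> E" "inner_on S f e \<noteq> 0"
    using norm_expansion[OF f(1)] by (metis (no_types, lifting) sum.neutral zero_power2)
  then have "t * (inner_on S f e)\<^sup>2 < ev e * (inner_on S f e)\<^sup>2"
    using orth[of e] by (cases "ev e \<le> t") (auto intro!: mult_strict_right_mono)
  then show ?thesis
    unfolding form_expansion[OF f(1)] norm_expansion[OF f(1)] sum_distrib_left
    using e(1) le finite_basis by (intro sum_strict_mono_ex1) blast+
qed

end

section \<open>Multiplicities and the sorted list of eigenvalues\<close>

interpretation fs: vector_space fun_scale
  by (rule vector_space_fun_scale)

lemma sum_fun_apply: "(\<Sum>i\<in>I. F i) x = (\<Sum>i\<in>I. F i x)" for F :: "'b \<Rightarrow> 'a \<Rightarrow> real"
  by (induction I rule: infinite_finite_induct) (simp_all add: zero_fun_def plus_fun_def)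

lemma sum_fun_scale: "(\<Sum>e\<in>B. fun_scale (c e) (F e)) = (\<lambda>x. \<Sum>e\<in>B. c e * F e x)"
  by (simp add: fun_eq_iff sum_fun_apply fun_scale_def)

lemma orthonormal_independent:
  assumes "orthonormal S E"
  shows "fs.independent E"
proof -
  have "finite E" using assms by (simp add: orthonormal_def)
  moreover have "c d = 0" if "(\<Sum>e\<in>E. fun_scale (c e) e) = 0" "d \<in> E" for c d
  proof -
    have "(\<lambda>x. \<Sum>e\<in>E. c e * e x) = (\<lambda>x. 0)"
      using that(1) by (simp add: sum_fun_scale zero_fun_def)
    then have "inner_on S (\<lambda>x. \<Sum>e\<in>E. c e * e x) d = 0" by (simp add: inner_on_def)
    then show ?thesis
      using orthonormal_coefficient[OF assms order_refl that(2), of c] that(2) by simp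
  qed
  ultimately show ?thesis
    using fs.dependent_finite by blast
qed

context eigenbasis
begin

definition eigenspace :: "real \<Rightarrow> ('a \<Rightarrow> real) set" where
  "eigenspace t = {f \<in> functions_on S. A f = fun_scale t f}"

lemma eigenspace_coefficient:
  assumes "f \<in> eigenspace t" "e \<in> E" "ev e \<noteq> t"
  shows "inner_on S f e = 0"
proof -
  have "ev e * inner_on S f e = t * inner_on S f e"
    using assms image_coefficient[of f e]
    by (simp add: eigenspace_def fun_scale_def inner_on_scale_right inner_on_commute[of S e f])
  then show ?thesis using assms(3) by simp
qed

lemma dim_eigenspace: "fs.dim (eigenspace t) = card {e \<in> E. ev e = t}"
proof (rule fs.dim_unique[OF _ _ _ refl])
  let ?B = "{e \<in> E. ev e = t}"
  show "?B \<subseteq> eigenspace t"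
    using eigenvector basis_in by (auto simp: eigenspace_def)
  show "fs.independent ?B"
    by (rule fs.independent_mono[OF orthonormal_independent[OF orthonormal]]) auto
  show "eigenspace t \<subseteq> fs.span ?B"
  proof
    fix f assume f: "f \<in> eigenspace t"
    then have "(\<lambda>x. \<Sum>e\<in>E. inner_on S f e * e x) = f"
      by (intro expansion) (simp add: eigenspace_def)
    moreover have "(\<Sum>e\<in>E. inner_on S f e * e x) = (\<Sum>e\<in>?B. inner_on S f e * e x)" for x
      using finite_basis eigenspace_coefficient[OF f]
      by (intro sum.mono_neutral_right) auto
    ultimately have "f = (\<Sum>e\<in>?B. fun_scale (inner_on S f e) e)"
      by (simp add: sum_fun_scale)
    also have "\<dots> \<in> fs.span ?B"
      by (intro fs.span_sum fs.span_scale fs.span_base)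
    finally show "f \<in> fs.span ?B" .
  qed
qed

lemma nonzero_eigenspace_iff: "(\<exists>f\<in>eigenspace t. f \<noteq> 0) \<longleftrightarrow> t \<in> ev ` E"
proof
  assume "\<exists>f\<in>eigenspace t. f \<noteq> 0"
  then obtain f where f: "f \<in> eigenspace t" "f \<noteq> (\<lambda>x. 0)" by (auto simp: zero_fun_def)
  show "t \<in> ev ` E"
  proof (rule ccontr)
    assume "t \<notin> ev ` E"
    then have "\<forall>e\<in>E. inner_on S f e = 0" using eigenspace_coefficient[OF f(1)] by blast
    then show False
      using expansion[of f] f by (simp add: eigenspace_def)
  qed
next
  assume "t \<in> ev ` E"
  then obtain e where e: "e \<in> E" "t = ev e" by blast
  then have "e \<in> eigenspace t"
    using eigenvector basis_in by (simp add: eigenspace_def)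
  moreover have "e \<noteq> 0" using basis_nonzero[OF e(1)] by (simp add: zero_fun_def)
  ultimately show "\<exists>f\<in>eigenspace t. f \<noteq> 0" by blast
qed

end

lemma nth_le_iff_less_length_filter:
  fixes xs :: "'b::linorder list"
  assumes "sorted xs" "i < length xs"
  shows "xs ! i \<le> t \<longleftrightarrow> i < length (filter (\<lambda>x. x \<le> t) xs)"
  using assms
proof (induction xs arbitrary: i)
  case (Cons x xs)
  show ?case
  proof (cases "x \<le> t")
    case True
    then show ?thesis using Cons by (cases i) auto
  next
    case False
    then have "filter (\<lambda>x. x \<le> t) xs = []"
      using Cons.prems(1) by (auto simp: filter_empty_conv)
    moreover have "x \<le> (x # xs) ! i" using Cons.prems by (cases i) auto
    ultimately show ?thesis using False by auto
  qed
qed simp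

lemma sorted_concat_replicate:
  fixes xs :: "real list"
  assumes "sorted xs"
  shows "sorted (concat (map (\<lambda>t. replicate (m t) t) xs))"
  using assms by (induction xs) (auto simp: sorted_append)

text \<open>
  The number of entries satisfying \<open>P\<close>: the total multiplicity of the eigenvalues that do.
\<close>

lemma length_filter_concat_replicate:
  assumes "distinct xs"
  shows "length (filter P (concat (map (\<lambda>t. replicate (m t) t) xs))) = (\<Sum>t | t \<in> set xs \<and> P t. m t)"
  using assms
proof (induction xs)
  case (Cons x xs)
  have "{t. t \<in> set (x # xs) \<and> P t} = (if P x then insert x {t \<in> set xs. P t} else {t \<in> set xs. P t})"
    by auto
  then show ?case using Cons by auto
qed simp

lemma (in eigenbasis) length_filter_eigenvalue_list:
  "length (filter P (concat (map (\<lambda>t. replicate (card {e \<in> E. ev e = t}) t)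
     (sorted_list_of_set (ev ` E))))) = card {e \<in> E. P (ev e)}"
proof -
  have "(\<Sum>t | t \<in> ev ` E \<and> P t. card {e \<in> E. ev e = t}) = card (\<Union>t\<in>{t \<in> ev ` E. P t}. {e \<in> E. ev e = t})"
    using finite_basis by (subst card_UN_disjoint) auto
  also have "(\<Union>t\<in>{t \<in> ev ` E. P t}. {e \<in> E. ev e = t}) = {e \<in> E. P (ev e)}"
    by auto
  finally show ?thesis
    using finite_basis by (simp add: length_filter_concat_replicate)
qed

section \<open>Comparison of spectra by counting dimensions\<close>

text \<open>
  Gaussian elimination: solve one equation for a variable \<open>p\<close> with nonzero coefficient and
  substitute into the others. This leaves one equation and one variable less.
\<close>

lemma underdetermined_system:
  fixes a :: "'k \<Rightarrow> 'j \<Rightarrow> real"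
  assumes "finite K" "finite J" "card K < card J"
  shows "\<exists>c. (\<exists>j\<in>J. c j \<noteq> 0) \<and> (\<forall>k\<in>K. (\<Sum>j\<in>J. a k j * c j) = 0)"
  using assms
proof (induction K arbitrary: J a rule: finite_induct)
  case empty
  then obtain j where "j \<in> J" by (metis card_gt_0_iff card.empty ex_in_conv)
  then show ?case by (intro exI[of _ "\<lambda>_. 1"]) auto
next
  case (insert k K)
  show ?case
  proof (cases "\<forall>j\<in>J. a k j = 0")
    case True
    obtain c where "\<exists>j\<in>J. c j \<noteq> 0" "\<forall>l\<in>K. (\<Sum>j\<in>J. a l j * c j) = 0"
      using insert.IH[of J a] insert.prems insert.hyps by auto
    then show ?thesis using True by (intro exI[of _ c]) auto
  next
    case False
    then obtain p where p: "p \<in> J" "a k p \<noteq> 0" by blast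
    let ?J = "J - {p}"
    have "finite ?J" "card K < card ?J"
      using insert p by auto
    then obtain c where c: "\<exists>j\<in>?J. c j \<noteq> 0"
      and sol: "\<forall>l\<in>K. (\<Sum>j\<in>?J. (a l j - a l p / a k p * a k j) * c j) = 0"
      using insert.IH[of ?J "\<lambda>l j. a l j - a l p / a k p * a k j"] by blast
    define s where "s = (\<Sum>j\<in>?J. a k j * c j)"
    define c' where "c' = c(p := - s / a k p)"
    have "(\<Sum>j\<in>?J. a l j * c' j) = (\<Sum>j\<in>?J. a l j * c j)" for l
      by (intro sum.cong) (auto simp: c'_def)
    then have split: "(\<Sum>j\<in>J. a l j * c' j) = a l p * (- s / a k p) + (\<Sum>j\<in>?J. a l j * c j)" for l
      unfolding sum.remove[OF insert.prems(1) p(1)] by (simp add: c'_def)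
    have "(\<Sum>j\<in>J. a l j * c' j) = 0" if l: "l \<in> insert k K" for l
    proof (cases "l = k")
      case True
      then show ?thesis using p unfolding split by (simp add: s_def)
    next
      case False
      then have "(\<Sum>j\<in>?J. a l j * c j - a l p / a k p * (a k j * c j)) = 0"
        using sol l by (auto simp: algebra_simps)
      then have "(\<Sum>j\<in>?J. a l j * c j) = a l p / a k p * s"
        by (simp add: sum_subtractf s_def sum_distrib_left)
      then show ?thesis unfolding split by simp
    qed
    moreover have "\<exists>j\<in>J. c' j \<noteq> 0" using c by (auto simp: c'_def)
    ultimately show ?thesis by blast
  qed
qed

definition pullback_on :: "'b set \<Rightarrow> ('b \<Rightarrow> 'a) \<Rightarrow> ('a \<Rightarrow> real) \<Rightarrow> 'b \<Rightarrow> real" where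
  "pullback_on S \<sigma> f = (\<lambda>y. if y \<in> S then f (\<sigma> y) else 0)"

text \<open>
  The min-max principle in counting form. A function on \<open>S1\<close> is transferred to \<open>S2\<close> by
  pulling it back along \<open>\<sigma>\<close>. If, for functions that vanish on \<open>C\<close>, the transfer is injective,
  does not increase the form and does not decrease \<open>t\<close> times the squared norm, then at most
  \<open>card C\<close> of the eigenvalues up to \<open>t\<close> are lost. The factor \<open>t\<close> in the last hypothesis covers
  both growing norms with \<open>0 \<le> t\<close> and equal norms with arbitrary \<open>t\<close>.
\<close>

lemma eigenvalue_count_comparison:
  assumes "eigenbasis S1 A1 E1 ev1" and "eigenbasis S2 A2 E2 ev2" and "finite C"
    and transfer: "\<And>f. \<lbrakk>f \<in> functions_on S1; f \<noteq> (\<lambda>x. 0); \<And>x. x \<in> C \<Longrightarrow> f x = 0\<rbrakk> \<Longrightarrow>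
      pullback_on S2 \<sigma> f \<noteq> (\<lambda>y. 0) \<and>
      inner_on S2 (pullback_on S2 \<sigma> f) (A2 (pullback_on S2 \<sigma> f)) \<le> inner_on S1 f (A1 f) \<and>
      t * inner_on S1 f f \<le> t * inner_on S2 (pullback_on S2 \<sigma> f) (pullback_on S2 \<sigma> f)"
  shows "card {e \<in> E1. ev1 e \<le> t} \<le> card {e \<in> E2. ev2 e \<le> t} + card C"
proof (rule ccontr)
  interpret b1: eigenbasis S1 A1 E1 ev1 by fact
  interpret b2: eigenbasis S2 A2 E2 ev2 by fact
  let ?X = "pullback_on S2 \<sigma>"
  let ?L1 = "{e \<in> E1. ev1 e \<le> t}" and ?L2 = "{e \<in> E2. ev2 e \<le> t}"
  \<comment> \<open>One equation for each point of \<open>C\<close> and one for each low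
    eigenvector of the second operator; the unknowns are the coefficients of the low eigenvectors of
    the first.\<close>
  let ?a = "\<lambda>k e. case k of Inl x \<Rightarrow> e x | Inr d \<Rightarrow> inner_on S2 (?X e) d"
  have fin: "finite ?L1" "finite ?L2" using b1.finite_basis b2.finite_basis by auto
  assume "\<not> card ?L1 \<le> card ?L2 + card C"
  then have "card (C <+> ?L2) < card ?L1"
    using \<open>finite C\<close> fin by (simp add: card_Plus)
  then obtain c where c: "\<exists>e\<in>?L1. c e \<noteq> 0"
    and sol: "\<And>k. k \<in> C <+> ?L2 \<Longrightarrow> (\<Sum>e\<in>?L1. ?a k e * c e) = 0"
    using underdetermined_system[of "C <+> ?L2" ?L1 ?a] \<open>finite C\<close> fin by auto
  define f where "f = (\<lambda>x. \<Sum>e\<in>?L1. c e * e x)"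
  have f: "f \<in> functions_on S1" unfolding f_def by (rule b1.combination_in) auto
  have "f \<noteq> (\<lambda>x. 0)"
  proof
    assume f0: "f = (\<lambda>x. 0)"
    have "c d = 0" if d: "d \<in> ?L1" for d
    proof -
      have "inner_on S1 f d = c d"
        unfolding f_def using orthonormal_coefficient[OF b1.orthonormal, of ?L1 d c] d by auto
      then show ?thesis by (simp add: f0 inner_on_def)
    qed
    then show False using c by blast
  qed
  moreover have "f x = 0" if "x \<in> C" for x
    using sol[OF InlI[OF that]] by (simp add: f_def mult.commute)
  ultimately have X: "?X f \<noteq> (\<lambda>y. 0)" "inner_on S2 (?X f) (A2 (?X f)) \<le> inner_on S1 f (A1 f)"
      "t * inner_on S1 f f \<le> t * inner_on S2 (?X f) (?X f)"
    using transfer[OF f] by blast+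
  have "inner_on S2 (?X f) d = 0" if "d \<in> E2" "ev2 d \<le> t" for d
  proof -
    have "?X f = (\<lambda>y. \<Sum>e\<in>?L1. c e * ?X e y)"
      by (auto simp: pullback_on_def f_def fun_eq_iff)
    then have "inner_on S2 (?X f) d = (\<Sum>e\<in>?L1. c e * inner_on S2 (?X e) d)"
      by (simp only: inner_on_sum_left)
    also have "\<dots> = 0"
      using sol[OF InrI[of d ?L2 C]] that by (simp add: mult.commute)
    finally show ?thesis .
  qed
  then have "t * inner_on S2 (?X f) (?X f) < inner_on S2 (?X f) (A2 (?X f))"
    by (intro b2.form_orthogonal_greater X) (auto simp: pullback_on_def functions_on_def)
  moreover have "inner_on S1 f (A1 f) \<le> t * inner_on S1 f f"
    unfolding f_def by (rule b1.form_combination_le) simp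
  ultimately show False using X by linarith
qed

section \<open>Retraction of a tree onto a subtree\<close>

text \<open>
  Otherwise take a path of added arcs, shortest among those joining two different vertices of
  the small tree. By minimality it meets the small tree only at its ends, so a path inside the
  small tree that leads back closes it to a cycle. The cycle has length at least 3: a cycle of
  length 2 would run back and forth along one edge, which would be both added and old.
\<close>

lemma added_arcs_path_unique:
  assumes "undirected_tree G1" "undirected_tree G2" and sub: "subgraph (with_proj G1) (with_proj G2)"
    and "(u, v) \<in> (parcs G2 - parcs G1)\<^sup>*" "u \<in> pverts G1" "v \<in> pverts G1"
  shows "u = v"
proof (rule ccontr)
  assume "u \<noteq> v"
  interpret G1: pair_graph G1 using assms(1) by (simp add: undirected_tree_def)
  interpret G2: pair_graph G2 using assms(2) by (simp add: undirected_tree_def)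
  let ?R = "parcs G2 - parcs G1"
  have V: "pverts G1 \<subseteq> pverts G2"
    using sub by (simp add: subgraph_def)
  have "\<exists>p. G2.awalk u p v \<and> set p \<subseteq> ?R"
    using assms(4)
  proof (induction rule: converse_rtrancl_induct)
    case base
    then show ?case using assms(6) V by (intro exI[of _ "[]"]) (auto simp: G2.awalk_Nil_iff)
  next
    case (step x y)
    then obtain p where p: "G2.awalk y p v" "set p \<subseteq> ?R" by blast
    then show ?case
      using step.hyps(1) by (intro exI[of _ "(x, y) # p"]) (auto simp: G2.awalk_Cons_iff)
  qed
  then obtain p0 where p0: "G2.awalk u p0 v" "set p0 \<subseteq> ?R" by blast
  define W where "W = (\<lambda>(x, p, y). x \<in> pverts G1 \<and> y \<in> pverts G1 \<and> x \<noteq> y \<and>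
    G2.apath x p y \<and> set p \<subseteq> ?R)"
  have "W (u, G2.awalk_to_apath p0, v)"
    using assms(5,6) \<open>u \<noteq> v\<close> G2.apath_awalk_to_apath[OF p0(1)] G2.awalk_to_apath_subset[OF p0(1)] p0(2)
    by (auto simp: W_def)
  then obtain w where w: "W w" "\<And>w'. W w' \<Longrightarrow> length (fst (snd w)) \<le> length (fst (snd w'))"
    using ex_has_least_nat[of W _ "\<lambda>w. length (fst (snd w))"] by blast
  obtain x p y where wxyz: "w = (x, p, y)" by (cases w)
  have xy: "x \<in> pverts G1" "y \<in> pverts G1" "x \<noteq> y" and p: "G2.apath x p y" "set p \<subseteq> ?R"
    using w(1) by (auto simp: W_def wxyz)
  have pw: "G2.awalk x p y" and pd: "distinct (pawalk_verts x p)"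
    using p(1) by (auto simp: G2.apath_def)
  have inner: "z = x \<or> z = y" if z: "z \<in> set (pawalk_verts x p)" "z \<in> pverts G1" for z
  proof (rule ccontr)
    assume nz: "\<not> (z = x \<or> z = y)"
    obtain q r where qr: "p = q @ r" "G2.awalk x q z" "G2.awalk z r y"
      using G2.awalk_decomp[OF pw z(1)] by blast
    have "last (pawalk_verts x q) = z" using qr(2) by simp
    then have "G2.apath x q z"
      using p(1) unfolding qr(1) G2.apath_append_iff by simp
    then have "W (x, q, z)"
      using z nz xy p(2) qr(1) by (auto simp: W_def)
    then have "r = []" using w(2)[of "(x, q, z)"] by (simp add: wxyz qr(1))
    then show False using qr(3) nz by (auto simp: G2.awalk_Nil_iff)
  qed
  have "strongly_connected (with_proj G1)"
    using assms(1) G1.symmetric_connected_imp_strongly_connected[OF G1.pair_sym_arcs]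
    by (simp add: undirected_tree_def)
  then have "y \<rightarrow>\<^sup>*\<^bsub>with_proj G1\<^esub> x" using xy by (auto simp: strongly_connected_def)
  then obtain q where q: "G1.apath y q x" by (auto simp: G1.reachable_apath)
  then have qd: "distinct (pawalk_verts y q)" and q1: "G1.awalk y q x"
    by (auto simp: G1.apath_def)
  have q2: "G2.awalk y q x" using q1 sub by (rule G2.subgraph_awalk_imp_awalk)
  have "set (pawalk_verts y q) \<subseteq> pverts G1"
    using q1 G1.awalk_verts_in_verts[of y q x] by auto
  have pne: "p \<noteq> []" and qne: "q \<noteq> []" using pw q1 xy by (auto simp: G1.awalk_Nil_iff G2.awalk_Nil_iff)
  have walk: "G2.awalk x (p @ q) x" using pw q2 by (rule G2.awalk_appendI)
  have verts: "pawalk_verts x (p @ q) = pawalk_verts x p @ tl (pawalk_verts y q)"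
    using G2.awalk_verts_append[OF walk] pw by simp
  have hdp: "pawalk_verts x p = x # tl (pawalk_verts x p)" by (cases p) (use pw in auto)
  have hdq: "pawalk_verts y q = y # tl (pawalk_verts y q)" by (cases q) (use q1 in auto)
  have "x \<notin> set (tl (pawalk_verts x p))" "y \<notin> set (tl (pawalk_verts y q))"
    using pd qd hdp hdq by (metis distinct.simps(2))+
  moreover have "set (tl (pawalk_verts x p)) \<subseteq> set (pawalk_verts x p)"
    "set (tl (pawalk_verts y q)) \<subseteq> set (pawalk_verts y q)"
    by (simp_all add: list.set_sel(2) subsetI)
  ultimately have "set (tl (pawalk_verts x p)) \<inter> set (tl (pawalk_verts y q)) = {}"
    using inner \<open>set (pawalk_verts y q) \<subseteq> pverts G1\<close> by blast
  moreover have "tl (pawalk_verts x (p @ q)) = tl (pawalk_verts x p) @ tl (pawalk_verts y q)"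
    unfolding verts by (subst hdp) simp
  ultimately have "distinct (tl (pawalk_verts x (p @ q)))"
    using pd qd by (simp add: distinct_tl)
  then have "G2.cycle (p @ q)" using walk pne by (auto simp: G2.cycle_def)
  moreover have "3 \<le> length (p @ q)"
  proof (rule ccontr)
    assume "\<not> 3 \<le> length (p @ q)"
    moreover have "0 < length p" "0 < length q" using pne qne by simp_all
    ultimately have "length p = 1 \<and> length q = 1" unfolding length_append by linarith
    then obtain d e where "p = [d]" "q = [e]" by (auto simp: length_Suc_conv)
    then have "(x, y) \<in> ?R"
      using p(2) pw by (cases d) (auto simp: G2.awalk_Cons_iff G2.awalk_Nil_iff)
    moreover have "(y, x) \<in> parcs G1"
      using q1 \<open>q = [e]\<close> by (cases e) (auto simp: G1.awalk_Cons_iff G1.awalk_Nil_iff)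
    ultimately show False
      using G1.pair_sym_arcs by (auto simp: symmetric_def dest: symD)
  qed
  ultimately show False using assms(2) by (auto simp: undirected_tree_def)
qed

text \<open>
  A vertex is sent to the vertex of the small tree in its component with respect to the added
  arcs, which is unique by the preceding lemma. Since the choice depends on the component only,
  the map is constant along added arcs.
\<close>

lemma tree_retraction:
  assumes "undirected_tree G1" "undirected_tree G2" "subgraph (with_proj G1) (with_proj G2)"
  obtains \<pi> where "\<And>v. v \<in> pverts G1 \<Longrightarrow> \<pi> v = v"
    and "\<And>x y. (x, y) \<in> parcs G2 - parcs G1 \<Longrightarrow> \<pi> x = \<pi> y"
proof -
  let ?R = "parcs G2 - parcs G1"
  define \<pi> where "\<pi> x = (SOME v. v \<in> pverts G1 \<and> (x, v) \<in> ?R\<^sup>*)" for x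
  interpret G1: pair_graph G1 using assms(1) by (simp add: undirected_tree_def)
  interpret G2: pair_graph G2 using assms(2) by (simp add: undirected_tree_def)
  have sym: "sym ?R"
    using G1.pair_sym_arcs G2.pair_sym_arcs by (auto simp: symmetric_def sym_def)
  show thesis
  proof (rule that)
    fix v assume v: "v \<in> pverts G1"
    show "\<pi> v = v" unfolding \<pi>_def
      by (rule some_equality) (use v added_arcs_path_unique[OF assms] in auto)
  next
    fix x y assume xy: "(x, y) \<in> ?R"
    then have "(y, x) \<in> ?R" using sym by (rule symD[rotated])
    with xy have "(x, v) \<in> ?R\<^sup>* \<longleftrightarrow> (y, v) \<in> ?R\<^sup>*" for v
      by (meson converse_rtrancl_into_rtrancl)
    then show "\<pi> x = \<pi> y" by (simp add: \<pi>_def)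
  qed
qed

section \<open>The Neumann Laplacian as the Laplacian of the interior\<close>

lemma interior_functions_eq: "interior_functions G = functions_on (interior_verts G)"
  by (simp add: interior_functions_def functions_on_def)

text \<open>
  The sum runs over arcs, and each edge is a pair of opposite arcs; hence the factor 1/2.
\<close>

definition energy :: "('a \<times> 'a) set \<Rightarrow> ('a \<Rightarrow> real) \<Rightarrow> real" where
  "energy P f = (\<Sum>(x, y)\<in>P. (f x - f y)\<^sup>2) / 2"

lemma energy_mono: "finite Q \<Longrightarrow> P \<subseteq> Q \<Longrightarrow> energy P f \<le> energy Q f"
  unfolding energy_def by (intro divide_right_mono sum_mono2) auto

lemma energy_nonneg: "0 \<le> energy P f"
  unfolding energy_def by (intro divide_nonneg_nonneg sum_nonneg) auto

lemma energy_cong: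
  assumes "\<And>x y. (x, y) \<in> P \<Longrightarrow> (f x - f y)\<^sup>2 = (g x - g y)\<^sup>2"
  shows "energy P f = energy P g"
  unfolding energy_def using assms by (intro arg_cong[where f = "\<lambda>s. s / 2"] sum.cong) auto

lemma energy_drop_flat:
  assumes "finite Q" "P \<subseteq> Q" and "\<And>x y. (x, y) \<in> Q - P \<Longrightarrow> f x = f y"
  shows "energy Q f = energy P f"
  unfolding energy_def using assms
  by (intro arg_cong[where f = "\<lambda>s. s / 2"] sum.mono_neutral_right) auto

definition interior_arcs :: "'a pair_pre_digraph \<Rightarrow> ('a \<times> 'a) set" where
  "interior_arcs G = parcs G \<inter> interior_verts G \<times> interior_verts G"

context pair_graph
begin

lemma sym_parcs: "(x, y) \<in> parcs G \<Longrightarrow> (y, x) \<in> parcs G"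
  using pair_sym_arcs by (auto simp: symmetric_def dest: symD)

lemma finite_interior: "finite (interior_verts G)"
  using pair_finite_verts by (simp add: interior_verts_def)

lemma finite_neighbours: "finite (neighbours G x)"
proof -
  have "neighbours G x \<subseteq> pverts G" by (auto simp: neighbours_def wellformed')
  then show ?thesis using pair_finite_verts finite_subset by blast
qed

lemma degree_eq_card_neighbours: "out_degree (with_proj G) x = card (neighbours G x)"
proof -
  have "out_arcs (with_proj G) x = Pair x ` neighbours G x"
    by (auto simp: out_arcs_def neighbours_def)
  then show ?thesis by (simp add: out_degree_def card_image inj_on_def)
qed

lemma boundary_neighbour_unique:
  assumes "y \<in> boundary G" "(x, y) \<in> parcs G"
  shows "neighbours G y = {x}"
proof -
  have "card (neighbours G y) = 1"
    using assms(1) by (simp add: boundary_def degree_eq_card_neighbours)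
  moreover have "x \<in> neighbours G y" using sym_parcs[OF assms(2)] by (simp add: neighbours_def)
  ultimately show ?thesis by (auto simp: card_1_singleton_iff)
qed

text \<open>
  A boundary neighbour of \<open>x\<close> has \<open>x\<close> as its only neighbour, so the extension gives it the value
  \<open>f x\<close> and its summand vanishes.
\<close>

lemma neumann_laplacian_interior:
  assumes "x \<in> interior_verts G"
  shows "neumann_laplacian G f x = (\<Sum>y\<in>neighbours G x \<inter> interior_verts G. f x - f y)"
proof -
  have "neumann_laplacian G f x =
      (\<Sum>y\<in>neighbours G x. neumann_extension G f x - neumann_extension G f y)"
    using assms by (simp add: neumann_laplacian_def laplacian_def)
  also have "\<dots> = (\<Sum>y\<in>neighbours G x. if y \<in> interior_verts G then f x - f y else 0)"
  proof (intro sum.cong refl)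
    fix y assume y: "y \<in> neighbours G x"
    then have xy: "(x, y) \<in> parcs G" by (simp add: neighbours_def)
    have x: "neumann_extension G f x = f x"
      using assms by (simp add: interior_verts_def neumann_extension_def)
    show "neumann_extension G f x - neumann_extension G f y =
        (if y \<in> interior_verts G then f x - f y else 0)"
    proof (cases "y \<in> boundary G")
      case True
      have "neumann_extension G f y = f x"
        using True by (simp add: neumann_extension_def degree_eq_card_neighbours
            boundary_neighbour_unique[OF True xy])
      then show ?thesis using True x by (simp add: interior_verts_def)
    next
      case False
      then show ?thesis
        using x in_arcsD2[OF xy] by (simp add: interior_verts_def neumann_extension_def)
    qed
  qed
  also have "\<dots> = (\<Sum>y\<in>neighbours G x \<inter> interior_verts G. f x - f y)"
    by (simp add: sum.inter_restrict finite_neighbours)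
  finally show ?thesis .
qed

text \<open>
  Summation by parts: the sum of \<open>f x * (f x - f y)\<close> over the arcs is unchanged when every arc
  is reversed, and the two versions add up to the sum of squares.
\<close>

lemma neumann_form: "inner_on (interior_verts G) f (neumann_laplacian G f) = energy (interior_arcs G) f"
proof -
  let ?S = "interior_verts G" and ?P = "interior_arcs G"
  have P: "?P = Sigma ?S (\<lambda>x. neighbours G x \<inter> ?S)"
    by (auto simp: interior_arcs_def neighbours_def)
  have "inner_on ?S f (neumann_laplacian G f) =
      (\<Sum>x\<in>?S. \<Sum>y\<in>neighbours G x \<inter> ?S. f x * (f x - f y))"
    unfolding inner_on_def by (intro sum.cong refl) (simp add: neumann_laplacian_interior sum_distrib_left)
  also have "\<dots> = (\<Sum>(x, y)\<in>?P. f x * (f x - f y))"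
    unfolding P by (rule sum.Sigma) (auto simp: finite_interior)
  finally have 1: "inner_on ?S f (neumann_laplacian G f) = (\<Sum>(x, y)\<in>?P. f x * (f x - f y))" .
  also have "\<dots> = (\<Sum>(x, y)\<in>?P. f y * (f y - f x))"
    by (rule sum.reindex_bij_witness[of _ prod.swap prod.swap])
       (auto simp: interior_arcs_def sym_parcs)
  finally have 2: "inner_on ?S f (neumann_laplacian G f) = (\<Sum>(x, y)\<in>?P. f y * (f y - f x))" .
  have "2 * inner_on ?S f (neumann_laplacian G f) =
      (\<Sum>(x, y)\<in>?P. f x * (f x - f y)) + (\<Sum>(x, y)\<in>?P. f y * (f y - f x))"
    using 1 2 by simp
  also have "\<dots> = (\<Sum>(x, y)\<in>?P. (f x - f y)\<^sup>2)"
    by (subst sum.distrib[symmetric]) (auto intro!: sum.cong simp: power2_eq_square algebra_simps)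
  finally show ?thesis by (simp add: energy_def)
qed

definition neumann_matrix :: "'a \<Rightarrow> 'a \<Rightarrow> real" where
  "neumann_matrix x y = (if x = y then real (card (neighbours G x \<inter> interior_verts G)) else 0) -
     (if (x, y) \<in> parcs G then 1 else 0)"

lemma neumann_laplacian_eq_matrix:
  "neumann_laplacian G f = mat_op (interior_verts G) neumann_matrix f"
proof
  fix x
  let ?S = "interior_verts G"
  show "neumann_laplacian G f x = mat_op ?S neumann_matrix f x"
  proof (cases "x \<in> ?S")
    case True
    have "mat_op ?S neumann_matrix f x =
        (\<Sum>y\<in>?S. (if x = y then real (card (neighbours G x \<inter> ?S)) * f y else 0)) -
        (\<Sum>y\<in>?S. if y \<in> neighbours G x then f y else 0)"
      using True unfolding sum_subtractf[symmetric]
      by (auto simp: mat_op_def neumann_matrix_def neighbours_def left_diff_distrib intro!: sum.cong)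
    also have "\<dots> = real (card (neighbours G x \<inter> ?S)) * f x - (\<Sum>y\<in>?S \<inter> neighbours G x. f y)"
      using True finite_interior by (simp add: sum.inter_restrict)
    also have "\<dots> = neumann_laplacian G f x"
      using True by (simp add: neumann_laplacian_interior sum_subtractf Int_commute)
    finally show ?thesis by simp
  qed (simp add: neumann_laplacian_def mat_op_def)
qed

lemma neumann_eigenbasis:
  obtains E ev where "eigenbasis (interior_verts G) (neumann_laplacian G) E ev"
proof -
  interpret symmetric_matrix "interior_verts G" neumann_matrix
    by unfold_locales (auto simp: finite_interior neumann_matrix_def sym_parcs)
  have "neumann_laplacian G = A"
    by (rule ext) (rule neumann_laplacian_eq_matrix)
  then show thesis
    using spectral_theorem that by metis
qed

end

lemma neumann_eigenvalues_eigenbasis: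
  assumes "eigenbasis (interior_verts G) (neumann_laplacian G) E ev"
  shows "sorted (neumann_eigenvalues G)"
    and "length (neumann_eigenvalues G) = card (interior_verts G)"
    and "set (neumann_eigenvalues G) \<subseteq> ev ` E"
    and "i < card (interior_verts G) \<Longrightarrow>
      neumann_eigenvalues G ! i \<le> t \<longleftrightarrow> i < card {e \<in> E. ev e \<le> t}"
proof -
  interpret eigenbasis "interior_verts G" "neumann_laplacian G" E ev by fact
  have space: "neumann_eigenspace G s = eigenspace s" for s
    by (simp add: neumann_eigenspace_def eigenspace_def interior_functions_eq)
  have list: "neumann_eigenvalues G =
      concat (map (\<lambda>t. replicate (card {e \<in> E. ev e = t}) t) (sorted_list_of_set (ev ` E)))"
    by (simp add: neumann_eigenvalues_def neumann_spectrum_def neumann_multiplicity_def space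
        nonzero_eigenspace_iff dim_eigenspace)
  show sorted: "sorted (neumann_eigenvalues G)"
    unfolding list by (rule sorted_concat_replicate) simp
  show length: "length (neumann_eigenvalues G) = card (interior_verts G)"
    using length_filter_eigenvalue_list[of "\<lambda>_. True"] by (simp add: list card_basis)
  show "set (neumann_eigenvalues G) \<subseteq> ev ` E"
    unfolding list using finite_basis by auto
  show "neumann_eigenvalues G ! i \<le> t \<longleftrightarrow> i < card {e \<in> E. ev e \<le> t}"
    if "i < card (interior_verts G)"
    using nth_le_iff_less_length_filter[OF sorted, of i t] that length
      length_filter_eigenvalue_list[of "\<lambda>s. s \<le> t"] by (simp add: list)
qed

lemma (in pair_graph) neumann_eigenvalue_nonneg:
  assumes "eigenbasis (interior_verts G) (neumann_laplacian G) E ev" "e \<in> E"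
  shows "0 \<le> ev e"
proof -
  interpret eigenbasis "interior_verts G" "neumann_laplacian G" E ev by fact
  have "inner_on (interior_verts G) e e = 1"
    using orthonormal assms(2) by (simp add: orthonormal_def)
  then have "ev e = inner_on (interior_verts G) e (neumann_laplacian G e)"
    using image_coefficient[OF basis_in] assms(2) by simp
  then show ?thesis by (simp add: neumann_form energy_nonneg)
qed

section \<open>Subtrees\<close>

text \<open>
  Degrees can only grow, and the small tree, being connected with more than one vertex, has no
  vertex of degree 0. So its interior vertices have degree at least 2 in both trees.
\<close>

lemma interior_subset:
  assumes "undirected_tree G1" "3 \<le> card (pverts G1)" "undirected_tree G2"
    and sub: "subgraph (with_proj G1) (with_proj G2)"
  shows "interior_verts G1 \<subseteq> interior_verts G2"
proof
  interpret G1: pair_graph G1 using assms(1) by (simp add: undirected_tree_def)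
  interpret G2: pair_graph G2 using assms(3) by (simp add: undirected_tree_def)
  fix x assume x: "x \<in> interior_verts G1"
  then have xV: "x \<in> pverts G1" by (simp add: interior_verts_def)
  have "\<not> pverts G1 \<subseteq> {x}"
    using assms(2) card_mono[of "{x}" "pverts G1"] by auto
  then obtain z where z: "z \<in> pverts G1" "z \<noteq> x" by blast
  have "strongly_connected (with_proj G1)"
    using assms(1) G1.symmetric_connected_imp_strongly_connected[OF G1.pair_sym_arcs]
    by (simp add: undirected_tree_def)
  then have "x \<rightarrow>\<^sup>*\<^bsub>with_proj G1\<^esub> z" using xV z by (auto simp: strongly_connected_def)
  then have "(x, z) \<in> (parcs G1)\<^sup>*" using reachable_rtranclI by fastforce
  then obtain y where "(x, y) \<in> parcs G1" using z(2) by (cases rule: converse_rtranclE) auto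
  then have "neighbours G1 x \<noteq> {}" by (auto simp: neighbours_def)
  then have "0 < card (neighbours G1 x)" using G1.finite_neighbours by (simp add: card_gt_0_iff)
  moreover have "card (neighbours G1 x) \<noteq> 1"
    using x by (simp add: interior_verts_def boundary_def G1.degree_eq_card_neighbours)
  moreover have "neighbours G1 x \<subseteq> neighbours G2 x"
    using sub by (auto simp: neighbours_def subgraph_def)
  then have "card (neighbours G1 x) \<le> card (neighbours G2 x)"
    by (intro card_mono G2.finite_neighbours)
  ultimately have "card (neighbours G2 x) \<noteq> 1" by linarith
  then show "x \<in> interior_verts G2"
    using xV sub by (auto simp: interior_verts_def boundary_def G2.degree_eq_card_neighbours subgraph_def)
qed

text \<open>
  The map sends a vertex of the large tree to its image under the retraction, and then a leaf of
  the small tree to its neighbour, as the Neumann extension does. The added arcs are collapsed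
  by the first step, the arcs between leaves and the interior by the second, and the interior
  arcs of the small tree are left in place.
\<close>

lemma extension_along_retraction:
  assumes tree: "undirected_tree G1" "undirected_tree G2"
    and sub: "subgraph (with_proj G1) (with_proj G2)"
  obtains \<sigma> where "\<And>x. x \<in> interior_verts G1 \<Longrightarrow> \<sigma> x = x"
    and "\<And>f. f \<in> functions_on (interior_verts G1) \<Longrightarrow>
      energy (interior_arcs G2) (\<lambda>x. f (\<sigma> x)) \<le> energy (interior_arcs G1) f"
proof -
  interpret G1: pair_graph G1 using assms(1) by (simp add: undirected_tree_def)
  interpret G2: pair_graph G2 using assms(2) by (simp add: undirected_tree_def)
  obtain \<pi> where fix_pi: "\<And>v. v \<in> pverts G1 \<Longrightarrow> \<pi> v = v"
    and collapse: "\<And>x y. (x, y) \<in> parcs G2 - parcs G1 \<Longrightarrow> \<pi> x = \<pi> y"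
    using tree_retraction[OF tree sub] by metis
  define \<rho> where "\<rho> x = (if x \<in> boundary G1 then THE y. (x, y) \<in> parcs G1 else x)" for x
  have rho: "\<rho> x = y" if "x \<in> boundary G1" "(x, y) \<in> parcs G1" for x y
    using that G1.boundary_neighbour_unique[OF that(1) G1.sym_parcs[OF that(2)]]
    unfolding \<rho>_def neighbours_def by (auto intro!: the_equality)
  have arcs: "parcs G1 \<subseteq> parcs G2" using sub by (simp add: subgraph_def)
  show thesis
  proof (rule that[of "\<lambda>x. \<rho> (\<pi> x)"])
    fix x assume "x \<in> interior_verts G1"
    then show "\<rho> (\<pi> x) = x" by (simp add: interior_verts_def fix_pi \<rho>_def)
  next
    fix f assume f: "f \<in> functions_on (interior_verts G1)"
    have int: "\<rho> x = x" if "x \<in> interior_verts G1" for x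
      using that by (simp add: interior_verts_def \<rho>_def)
    \<comment> \<open>Two adjacent leaves are interchanged by \<open>\<rho>\<close>, but
      \<open>f\<close> vanishes at both.\<close>
    have flat: "f (\<rho> x) = f (\<rho> y)" if xy: "(x, y) \<in> parcs G1 - interior_arcs G1" for x y
    proof -
      have a: "(x, y) \<in> parcs G1" "(y, x) \<in> parcs G1" using xy G1.sym_parcs by auto
      have c: "z \<in> boundary G1 \<or> z \<in> interior_verts G1" if "z \<in> {x, y}" for z
        using that a G1.wellformed' by (auto simp: interior_verts_def)
      have out: "f z = 0" if "z \<in> boundary G1" for z
        using f that by (simp add: functions_on_def interior_verts_def)
      consider "x \<in> boundary G1" "y \<in> boundary G1" | "x \<in> boundary G1" "y \<in> interior_verts G1"
        | "x \<in> interior_verts G1" "y \<in> boundary G1"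
        using c[of x] c[of y] xy by (auto simp: interior_arcs_def)
      then show ?thesis
        by cases (simp_all add: rho[OF _ a(1)] rho[OF _ a(2)] int out)
    qed
    have "energy (interior_arcs G2) (\<lambda>x. f (\<rho> (\<pi> x))) \<le> energy (parcs G2) (\<lambda>x. f (\<rho> (\<pi> x)))"
      by (intro energy_mono G2.pair_finite_arcs) (auto simp: interior_arcs_def)
    also have "\<dots> = energy (parcs G1) (\<lambda>x. f (\<rho> (\<pi> x)))"
      by (intro energy_drop_flat G2.pair_finite_arcs arcs) (simp add: collapse)
    also have "\<dots> = energy (parcs G1) (\<lambda>x. f (\<rho> x))"
      by (intro energy_cong) (simp add: fix_pi G1.wellformed')
    also have "\<dots> = energy (interior_arcs G1) (\<lambda>x. f (\<rho> x))"
      by (intro energy_drop_flat G1.pair_finite_arcs flat) (auto simp: interior_arcs_def)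
    also have "\<dots> = energy (interior_arcs G1) f"
      by (intro energy_cong) (auto simp: interior_arcs_def int)
    finally show "energy (interior_arcs G2) (\<lambda>x. f (\<rho> (\<pi> x))) \<le> energy (interior_arcs G1) f" .
  qed
qed

theorem theorem1p3:
  fixes G1 G2 :: "'a pair_pre_digraph" and k1 k2 i :: nat
  assumes "undirected_tree G1" and "3 \<le> card (pverts G1)"
    and "undirected_tree G2" and "3 \<le> card (pverts G2)"
    and "subgraph (with_proj G1) (with_proj G2)"
    and "k1 = card (interior_verts G1)" and "k2 = card (interior_verts G2)"
    and "1 \<le> i" and "i \<le> k1"
  shows "neumann_eigenvalue G2 i \<le> neumann_eigenvalue G1 i \<and>
         neumann_eigenvalue G1 i \<le> neumann_eigenvalue G2 (i + k2 - k1)"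
proof -
  interpret G1: pair_graph G1 using assms(1) by (simp add: undirected_tree_def)
  interpret G2: pair_graph G2 using assms(3) by (simp add: undirected_tree_def)
  let ?S1 = "interior_verts G1" and ?S2 = "interior_verts G2"
  let ?L1 = "neumann_laplacian G1" and ?L2 = "neumann_laplacian G2"
  obtain E1 ev1 where b1: "eigenbasis ?S1 ?L1 E1 ev1" by (rule G1.neumann_eigenbasis)
  obtain E2 ev2 where b2: "eigenbasis ?S2 ?L2 E2 ev2" by (rule G2.neumann_eigenbasis)
  note list1 = neumann_eigenvalues_eigenbasis[OF b1] and list2 = neumann_eigenvalues_eigenbasis[OF b2]
  have S: "?S1 \<subseteq> ?S2" using interior_subset assms by blast
  have k: "k1 \<le> k2" using S assms(6,7) G2.finite_interior by (simp add: card_mono)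
  obtain \<sigma> where retract: "\<And>x. x \<in> ?S1 \<Longrightarrow> \<sigma> x = x"
    and contract: "\<And>f. f \<in> functions_on ?S1 \<Longrightarrow>
      energy (interior_arcs G2) (\<lambda>x. f (\<sigma> x)) \<le> energy (interior_arcs G1) f"
    using extension_along_retraction[OF assms(1,3,5)] by metis

  \<comment> \<open>A constant extension does not increase the energy and does not decrease the
    norm; the latter helps because the eigenvalues concerned are nonnegative.\<close>
  have lower: "card {e \<in> E1. ev1 e \<le> t} \<le> card {e \<in> E2. ev2 e \<le> t} + card ({} :: 'a set)" if t: "0 \<le> t" for t
  proof (rule eigenvalue_count_comparison[where \<sigma> = \<sigma>, OF b1 b2])
    fix f :: "'a \<Rightarrow> real" assume f: "f \<in> functions_on ?S1" "f \<noteq> (\<lambda>x. 0)"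
    let ?g = "pullback_on ?S2 \<sigma> f"
    have g: "?g x = f x" if "x \<in> ?S1" for x
      using that S by (auto simp: pullback_on_def retract)
    obtain x where "f x \<noteq> 0" using f(2) by auto
    moreover from this have "x \<in> ?S1" using f(1) by (auto simp: functions_on_def)
    ultimately have "?g x \<noteq> 0" using g by simp
    then have "?g \<noteq> (\<lambda>y. 0)" using fun_cong[of ?g "\<lambda>y. 0" x] by blast
    moreover have "energy (interior_arcs G2) ?g = energy (interior_arcs G2) (\<lambda>x. f (\<sigma> x))"
      by (rule energy_cong) (simp add: pullback_on_def interior_arcs_def)
    then have "inner_on ?S2 ?g (?L2 ?g) \<le> inner_on ?S1 f (?L1 f)"
      using contract[OF f(1)] by (simp add: G1.neumann_form G2.neumann_form)
    moreover have "inner_on ?S1 f f \<le> inner_on ?S2 ?g ?g"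
    proof -
      have "inner_on ?S1 f f = inner_on ?S1 ?g ?g" unfolding inner_on_def by (intro sum.cong refl) (simp only: g)
      also have "\<dots> \<le> inner_on ?S2 ?g ?g"
        unfolding inner_on_def using S G2.finite_interior by (intro sum_mono2) auto
      finally show ?thesis .
    qed
    then have "t * inner_on ?S1 f f \<le> t * inner_on ?S2 ?g ?g" using t by (rule mult_left_mono)
    ultimately show "?g \<noteq> (\<lambda>y. 0) \<and> inner_on ?S2 ?g (?L2 ?g) \<le> inner_on ?S1 f (?L1 f) \<and>
        t * inner_on ?S1 f f \<le> t * inner_on ?S2 ?g ?g" by blast
  qed simp

  \<comment> \<open>Functions vanishing at the added interior vertices keep their norm and gain no
    energy when they are restricted.\<close>
  have upper: "card {e \<in> E2. ev2 e \<le> t} \<le> card {e \<in> E1. ev1 e \<le> t} + card (?S2 - ?S1)" for t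
  proof (rule eigenvalue_count_comparison[where \<sigma> = id, OF b2 b1])
    fix f :: "'a \<Rightarrow> real" assume f: "f \<in> functions_on ?S2" "f \<noteq> (\<lambda>x. 0)"
      "\<And>x. x \<in> ?S2 - ?S1 \<Longrightarrow> f x = 0"
    have g: "pullback_on ?S1 id f = f"
      using f(1,3) by (auto simp: pullback_on_def fun_eq_iff functions_on_def)
    have "interior_arcs G1 \<subseteq> interior_arcs G2"
      using S assms(5) by (auto simp: interior_arcs_def subgraph_def)
    moreover have "finite (interior_arcs G2)"
      by (simp add: interior_arcs_def G2.pair_finite_arcs)
    ultimately have "inner_on ?S1 f (?L1 f) \<le> inner_on ?S2 f (?L2 f)"
      by (simp add: G1.neumann_form G2.neumann_form energy_mono)
    moreover have "inner_on ?S1 f f = inner_on ?S2 f f"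
      unfolding inner_on_def using S f(3) G2.finite_interior by (intro sum.mono_neutral_left) auto
    ultimately show "pullback_on ?S1 id f \<noteq> (\<lambda>y. 0) \<and>
        inner_on ?S1 (pullback_on ?S1 id f) (?L1 (pullback_on ?S1 id f)) \<le> inner_on ?S2 f (?L2 f) \<and>
        t * inner_on ?S2 f f \<le> t * inner_on ?S1 (pullback_on ?S1 id f) (pullback_on ?S1 id f)"
      unfolding g using f(2) by simp
  qed (simp add: G2.finite_interior)

  have "neumann_eigenvalues G2 ! (i - 1) \<le> neumann_eigenvalues G1 ! (i - 1)"
  proof -
    let ?t = "neumann_eigenvalues G1 ! (i - 1)"
    have i: "i - 1 < card ?S1" "i - 1 < card ?S2" using assms(6-9) k by linarith+
    have "?t \<in> set (neumann_eigenvalues G1)" using i(1) list1(2) by simp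
    then obtain e where "e \<in> E1" "?t = ev1 e" using list1(3) by blast
    then have "0 \<le> ?t" using G1.neumann_eigenvalue_nonneg[OF b1] by simp
    moreover have "i - 1 < card {e \<in> E1. ev1 e \<le> ?t}" using list1(4)[OF i(1), of ?t] by simp
    ultimately have "i - 1 < card {e \<in> E2. ev2 e \<le> ?t}" using lower[of ?t] by simp
    then show ?thesis using list2(4)[OF i(2)] by simp
  qed
  moreover have "neumann_eigenvalues G1 ! (i - 1) \<le> neumann_eigenvalues G2 ! (i + k2 - k1 - 1)"
  proof -
    let ?t = "neumann_eigenvalues G2 ! (i + k2 - k1 - 1)"
    have i: "i - 1 < card ?S1" "i + k2 - k1 - 1 < card ?S2" using assms(6-9) k by linarith+
    have "card (?S2 - ?S1) = k2 - k1"
      using S assms(6,7) G1.finite_interior by (simp add: card_Diff_subset)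
    moreover have "i + k2 - k1 - 1 < card {e \<in> E2. ev2 e \<le> ?t}" using list2(4)[OF i(2), of ?t] by simp
    ultimately have "i - 1 < card {e \<in> E1. ev1 e \<le> ?t}"
      using upper[of ?t] k assms(8) by linarith
    then show ?thesis using list1(4)[OF i(1)] by simp
  qed
  ultimately show ?thesis by (simp add: neumann_eigenvalue_def)
qed

end
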